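(* Let $x_1,\dots,x_n\in\mathbb{R}^d$ and $\sigma>0$. Let $(X_t)_{t\ge 0}$ be the Markov chain on $\{x_1,\dots,x_n\}$ with transition probabilities $$\mathbb{P}(X_t=x_j\mid X_{t-1}=x_i)=\frac{\exp(-\|x_i-x_j\|_2^2/\sigma^2)}{\sum_{k=1}^n\exp(-\|x_i-x_k\|_2^2/\sigma^2)},$$ and let $C_{ij}$ be the number of times that $X_{t-1}=x_i$ and $X_t=x_j$ over $m$ steps of this chain. Then for any $\delta>0$ and $\varepsilon>0$ there exist some $m$ and constants $a_i^m$ and $b_j^m$ ($1\le i,j\le n$) such that $$\mathbb{P}\left(\sup_{i,j}\left|-\log(C_{ij})-\|x_i-x_j\|_2^2/\sigma^2+a_i^m+b_j^m\right|>\delta\right)<\varepsilon .$$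
   Context: The number of points $n$, the dimension $d$, the points $x_i$ and $\sigma$ are fixed; only the number of steps $m$ varies. The initial state of the chain is arbitrary. The event $X_t=x_j$ means that the chain is in the state indexed by $j$. The counts $C_{ij}$ depend on $m$ and are random. Convention: $-\log 0=+\infty$, so the event in the probability includes the event that some $C_{ij}=0$. *)

theory Defs
  imports "HOL-Probability.Probability"
begin

definition gauss_transition :: "('n::finite \<Rightarrow> real ^ 'd) \<Rightarrow> real \<Rightarrow> 'n \<Rightarrow> 'n \<Rightarrow> real" where
  "gauss_transition x \<sigma> i j =
     exp (- (norm (x i - x j))\<^sup>2 / \<sigma>\<^sup>2) / (\<Sum>k\<in>UNIV. exp (- (norm (x i - x k))\<^sup>2 / \<sigma>\<^sup>2))"

text \<open>
  A discrete-time, time-homogeneous Markov chain with transition probabilities \<open>K\<close> on a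
  countable state type. The law of \<open>X 0\<close> is unconstrained. Conditional probabilities are
  prescribed only given histories of positive probability.
\<close>
locale markov_chain = prob_space M
  for M :: "'w measure" and K :: "'s::countable \<Rightarrow> 's \<Rightarrow> real" and X :: "nat \<Rightarrow> 'w \<Rightarrow> 's" +
  assumes random_variable_X: "\<And>t. random_variable (count_space UNIV) (X t)"
    and markov: "\<And>t h j. \<P>(\<omega> in M. \<forall>s\<le>t. X s \<omega> = h s) > 0 \<Longrightarrow>
      \<P>(\<omega> in M. X (Suc t) \<omega> = j \<bar> \<forall>s\<le>t. X s \<omega> = h s) = K (h t) j"

definition transition_count :: "(nat \<Rightarrow> 'w \<Rightarrow> 's) \<Rightarrow> nat \<Rightarrow> 's \<Rightarrow> 's \<Rightarrow> 'w \<Rightarrow> nat" where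
  "transition_count X m i j \<omega> = card {t \<in> {1..m}. X (t - 1) \<omega> = i \<and> X t \<omega> = j}"

text \<open>
  Extended-real valued because \<open>- log 0\<close> is taken to be \<open>\<infinity>\<close>, whereas \<open>ln (0::real) = 0\<close>.
\<close>
definition neg_log :: "nat \<Rightarrow> ereal" where
  "neg_log c = (if c = 0 then \<infinity> else ereal (- ln (real c)))"

end

theory Submission
  imports Defs
begin

text \<open>
  With \<open>N\<^sub>i\<close> the number of visits to \<open>i\<close> before time \<open>m\<close>, the process \<open>C\<^sub>i\<^sub>j - N\<^sub>i K\<^sub>i\<^sub>j\<close> is a
  martingale with increments bounded by 1, so it has second moment at most \<open>m\<close> and is \<open>o(m)\<close> in
  probability by Chebyshev. Summing over \<open>i\<close>, and because \<open>\<Sum>\<^sub>i C\<^sub>i\<^sub>j\<close> differs from \<open>N\<^sub>j\<close> by at most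
  1, the occupation frequencies \<open>N / m\<close> are almost invariant under \<open>K\<close>. As all entries of \<open>K\<close> are
  positive, \<open>K\<close> contracts signed vectors of total mass 0 in the \<open>l\<^sup>1\<close> norm (Doeblin), which forces
  \<open>N / m\<close> to be close to the stationary distribution \<open>\<pi>\<close>. For the Gaussian weights \<open>w\<close>, which are
  symmetric, \<open>\<pi>\<^sub>i\<close> is proportional to the row sum \<open>Z\<^sub>i\<close>, so \<open>\<pi>\<^sub>i K\<^sub>i\<^sub>j = w\<^sub>i\<^sub>j / W\<close> with \<open>W = \<Sum>\<^sub>i Z\<^sub>i\<close>.
  Hence \<open>C\<^sub>i\<^sub>j\<close> is close to \<open>m w\<^sub>i\<^sub>j / W\<close>, and \<open>a\<^sub>i = ln (m / W)\<close>, \<open>b\<^sub>j = 0\<close> work.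
\<close>

section \<open>Transition counts and the second moment of their martingale part\<close>

lemma transition_count_eq_sum:
  "real (transition_count X m i j \<omega>) = (\<Sum>t<m. of_bool (X t \<omega> = i) * of_bool (X (Suc t) \<omega> = j))"
proof -
  have "{t \<in> {1..m}. X (t - 1) \<omega> = i \<and> X t \<omega> = j}
      = Suc ` {t \<in> {..<m}. X t \<omega> = i \<and> X (Suc t) \<omega> = j}"
    by (auto simp: image_iff gr0_conv_Suc Suc_le_eq)
  then have "transition_count X m i j \<omega> = card {t \<in> {..<m}. X t \<omega> = i \<and> X (Suc t) \<omega> = j}"
    unfolding transition_count_def by (simp add: card_image)
  also have "real \<dots> = (\<Sum>t<m. of_bool (X t \<omega> = i \<and> X (Suc t) \<omega> = j))"
    by (simp add: sum_of_bool_eq Int_def)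
  finally show ?thesis
    by (simp only: of_bool_conj)
qed

text \<open>\<open>markov\<close> ties \<open>K\<close> to the chain only at states reached with
  positive probability, so bounds on all entries of \<open>K\<close> are separate
  assumptions.\<close>

locale finite_markov_chain = markov_chain M K X
  for M :: "'w measure" and K :: "'s::finite \<Rightarrow> 's \<Rightarrow> real" and X :: "nat \<Rightarrow> 'w \<Rightarrow> 's" +
  assumes K_nonneg: "0 \<le> K i j" and K_le_1: "K i j \<le> 1"
begin

declare random_variable_X[measurable]

definition compensated_count :: "nat \<Rightarrow> 's \<Rightarrow> 's \<Rightarrow> 'w \<Rightarrow> real" where
  "compensated_count m i j \<omega> =
    (\<Sum>t<m. of_bool (X t \<omega> = i) * (of_bool (X (Suc t) \<omega> = j) - K i j))"

lemma compensated_count_Suc: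
  "compensated_count (Suc m) i j \<omega> = compensated_count m i j \<omega> +
    of_bool (X m \<omega> = i) * (of_bool (X (Suc m) \<omega> = j) - K i j)"
  by (simp add: compensated_count_def)

text \<open>The Markov property in product form, free of division: for a null history both sides
  vanish.\<close>

lemma prob_history_step:
  "\<P>(\<omega> in M. X (Suc t) \<omega> = j \<and> (\<forall>s\<le>t. X s \<omega> = h s)) = K (h t) j * \<P>(\<omega> in M. \<forall>s\<le>t. X s \<omega> = h s)"
proof (cases "\<P>(\<omega> in M. \<forall>s\<le>t. X s \<omega> = h s) > 0")
  case True
  then show ?thesis
    using markov[OF True, of j] by (simp add: cond_prob_def field_simps)
next
  case False
  then have "\<P>(\<omega> in M. \<forall>s\<le>t. X s \<omega> = h s) = 0"
    by (simp add: zero_less_measure_iff)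
  moreover have "\<P>(\<omega> in M. X (Suc t) \<omega> = j \<and> (\<forall>s\<le>t. X s \<omega> = h s)) \<le> \<P>(\<omega> in M. \<forall>s\<le>t. X s \<omega> = h s)"
    by (intro finite_measure_mono) auto
  ultimately show ?thesis
    by (simp add: measure_le_0_iff)
qed

text \<open>Martingale orthogonality without conditional expectations: the history up to
  \<open>t\<close> takes finitely many values, so the product is a finite combination of indicators
  of history events, and each term integrates to 0 by \<open>prob_history_step\<close>.\<close>

lemma expectation_history_times_increment:
  fixes F :: "(nat \<Rightarrow> 's) \<Rightarrow> real"
  shows "expectation (\<lambda>\<omega>. F (restrict (\<lambda>s. X s \<omega>) {..t}) *
    (of_bool (X t \<omega> = i) * (of_bool (X (Suc t) \<omega> = j) - K i j))) = 0"
proof -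
  define H where "H = ({..t} \<rightarrow>\<^sub>E (UNIV :: 's set))"
  define A where "A h = {\<omega> \<in> space M. \<forall>s\<le>t. X s \<omega> = h s}" for h
  define B where "B h = {\<omega> \<in> space M. X (Suc t) \<omega> = j \<and> (\<forall>s\<le>t. X s \<omega> = h s)}" for h
  have meas: "A h \<in> events" "B h \<in> events" for h
    unfolding A_def B_def by measurable
  have int: "integrable M (indicat_real (A h))" "integrable M (indicat_real (B h))" for h
    using meas by (auto intro!: integrable_real_indicator simp: less_top[symmetric])
  have fin: "finite H"
    unfolding H_def by (intro finite_PiE) auto
  have "F (restrict (\<lambda>s. X s \<omega>) {..t}) * (of_bool (X t \<omega> = i) * (of_bool (X (Suc t) \<omega> = j) - K i j))
      = (\<Sum>h\<in>H. F h * of_bool (h t = i) * (indicator (B h) \<omega> - K (h t) j * indicator (A h) \<omega>))"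
    if "\<omega> \<in> space M" for \<omega>
  proof -
    define g where "g = restrict (\<lambda>s. X s \<omega>) {..t}"
    have g: "g \<in> H"
      unfolding g_def H_def by auto
    \<comment> \<open>Distinct histories give disjoint events, so the sum over \<open>H\<close>
      reduces to the realised history \<open>g\<close>.\<close>
    have "\<omega> \<notin> A h" if "h \<in> H" "h \<noteq> g" for h
    proof
      assume "\<omega> \<in> A h"
      then have "h s = g s" if "s \<in> {..t}" for s
        using that by (simp add: A_def g_def)
      then have "h = g"
        using that(1) g unfolding H_def by (intro PiE_ext)
      with that(2) show False by simp
    qed
    moreover have "B h \<subseteq> A h" for h
      unfolding A_def B_def by auto
    ultimately have "(\<Sum>h\<in>H - {g}. F h * of_bool (h t = i) * (indicator (B h) \<omega> - K (h t) j * indicator (A h) \<omega>)) = 0"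
      by (intro sum.neutral) (auto simp: indicator_def subset_iff)
    then have "(\<Sum>h\<in>H. F h * of_bool (h t = i) * (indicator (B h) \<omega> - K (h t) j * indicator (A h) \<omega>))
        = F g * of_bool (g t = i) * (indicator (B g) \<omega> - K (g t) j * indicator (A g) \<omega>)"
      using g fin by (simp add: sum.remove)
    also have "\<dots> = F g * (of_bool (X t \<omega> = i) * (of_bool (X (Suc t) \<omega> = j) - K i j))"
      using that by (auto simp: g_def A_def B_def indicator_def)
    finally show ?thesis by (simp add: g_def)
  qed
  then have "expectation (\<lambda>\<omega>. F (restrict (\<lambda>s. X s \<omega>) {..t}) *
        (of_bool (X t \<omega> = i) * (of_bool (X (Suc t) \<omega> = j) - K i j)))
      = expectation (\<lambda>\<omega>. \<Sum>h\<in>H. F h * of_bool (h t = i) * (indicator (B h) \<omega> - K (h t) j * indicator (A h) \<omega>))"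
    by (intro Bochner_Integration.integral_cong) auto
  also have "\<dots> = (\<Sum>h\<in>H. F h * of_bool (h t = i) * (prob (B h) - K (h t) j * prob (A h)))"
    using int meas by simp
  also have "\<dots> = 0"
    using prob_history_step[of t j] by (simp add: A_def B_def)
  finally show ?thesis .
qed

lemma measurable_compensated_count[measurable]: "compensated_count m i j \<in> borel_measurable M"
  unfolding compensated_count_def by measurable

lemma abs_increment_le_1: "\<bar>of_bool P * (of_bool Q - K i j)\<bar> \<le> 1"
  using K_nonneg[of i j] K_le_1[of i j] by (cases P; cases Q) auto

lemma abs_compensated_count_le: "\<bar>compensated_count m i j \<omega>\<bar> \<le> real m"
proof -
  have "\<bar>compensated_count m i j \<omega>\<bar> \<le> (\<Sum>t<m. 1)"
    unfolding compensated_count_def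
    by (intro order_trans[OF sum_abs] sum_mono abs_increment_le_1)
  then show ?thesis by simp
qed

text \<open>Increments are orthogonal to the past, so the cross term vanishes and each step adds at
  most 1.\<close>

lemma expectation_compensated_count_square_le:
  "expectation (\<lambda>\<omega>. (compensated_count m i j \<omega>)\<^sup>2) \<le> real m"
proof (induction m)
  case 0
  then show ?case by (simp add: compensated_count_def)
next
  case (Suc m)
  define S where "S = compensated_count m i j"
  define D where "D \<omega> = of_bool (X m \<omega> = i) * (of_bool (X (Suc m) \<omega> = j) - K i j)" for \<omega>
  have D_meas[measurable]: "D \<in> borel_measurable M"
    unfolding D_def by measurable
  have S_meas[measurable]: "S \<in> borel_measurable M"
    unfolding S_def by measurable
  have S_le: "\<bar>S \<omega>\<bar> \<le> real m" for \<omega>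
    unfolding S_def by (rule abs_compensated_count_le)
  have D_le: "\<bar>D \<omega>\<bar> \<le> 1" for \<omega>
    unfolding D_def by (rule abs_increment_le_1)
  have "norm ((S \<omega>)\<^sup>2) \<le> (real m)\<^sup>2" for \<omega>
    using power_mono[OF S_le, of \<omega> 2] by simp
  then have int1: "integrable M (\<lambda>\<omega>. (S \<omega>)\<^sup>2)"
    by (intro integrable_const_bound[of _ "(real m)\<^sup>2"]) auto
  have D2: "(D \<omega>)\<^sup>2 \<le> 1" for \<omega>
    using power_mono[OF D_le, of \<omega> 2] by simp
  then have int2: "integrable M (\<lambda>\<omega>. (D \<omega>)\<^sup>2)"
    by (intro integrable_const_bound[of _ 1]) auto
  have "norm (S \<omega> * D \<omega>) \<le> real m" for \<omega>
    using mult_mono[OF S_le D_le, of \<omega> \<omega>] by (simp add: abs_mult)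
  then have int3: "integrable M (\<lambda>\<omega>. S \<omega> * D \<omega>)"
    by (intro integrable_const_bound[of _ "real m"]) auto
  \<comment> \<open>For \<open>t < m\<close> the index \<open>Suc t\<close> is at most
    \<open>m\<close>, so \<open>S\<close> is a function of the history up to time \<open>m\<close>
    and hence orthogonal to \<open>D\<close>.\<close>
  have "S \<omega> = (\<lambda>h. \<Sum>t<m. of_bool (h t = i) * (of_bool (h (Suc t) = j) - K i j))
      (restrict (\<lambda>s. X s \<omega>) {..m})" for \<omega>
    unfolding S_def compensated_count_def by (auto intro!: sum.cong)
  then have SD: "expectation (\<lambda>\<omega>. S \<omega> * D \<omega>) = 0"
    unfolding D_def
    using expectation_history_times_increment[of
        "\<lambda>h. \<Sum>t<m. of_bool (h t = i) * (of_bool (h (Suc t) = j) - K i j)" m i j]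
    by simp
  have "expectation (\<lambda>\<omega>. (compensated_count (Suc m) i j \<omega>)\<^sup>2)
      = expectation (\<lambda>\<omega>. (S \<omega>)\<^sup>2 + 2 * (S \<omega> * D \<omega>) + (D \<omega>)\<^sup>2)"
    by (simp only: S_def[symmetric] compensated_count_Suc D_def[symmetric] power2_sum)
      (simp add: ac_simps)
  also have "\<dots> = expectation (\<lambda>\<omega>. (S \<omega>)\<^sup>2) + expectation (\<lambda>\<omega>. (D \<omega>)\<^sup>2)"
    using int1 int2 int3 SD by simp
  also have "expectation (\<lambda>\<omega>. (D \<omega>)\<^sup>2) \<le> 1"
    using int2 D2 by (intro integral_le_const) auto
  finally show ?case
    using Suc.IH by (simp add: S_def)
qed

text \<open>Chebyshev's inequality for each pair \<open>(i, j)\<close>, then a union bound over all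
  pairs.\<close>

lemma prob_compensated_count_ge:
  fixes \<eta> :: real
  assumes "\<eta> > 0" "m > 0"
  shows "\<P>(\<omega> in M. \<exists>i j. \<bar>compensated_count m i j \<omega>\<bar> \<ge> \<eta> * m) \<le> (real CARD('s))\<^sup>2 / (\<eta>\<^sup>2 * m)"
proof -
  define E where "E = (\<lambda>(i, j). {\<omega> \<in> space M. \<bar>compensated_count m i j \<omega>\<bar> \<ge> \<eta> * m})"
  have E_prob: "prob (E p) \<le> 1 / (\<eta>\<^sup>2 * m)" for p
  proof (cases p)
    case (Pair i j)
    have le: "norm ((compensated_count m i j \<omega>)\<^sup>2) \<le> (real m)\<^sup>2" for \<omega>
      using power_mono[OF abs_compensated_count_le[of m i j \<omega>], of 2] by simp
    have int: "integrable M (\<lambda>\<omega>. (compensated_count m i j \<omega>)\<^sup>2)"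
      using le by (intro integrable_const_bound[of _ "(real m)\<^sup>2"]) auto
    have "E p = {\<omega> \<in> space M. (\<eta> * m)\<^sup>2 \<le> (compensated_count m i j \<omega>)\<^sup>2}"
      using assms by (auto simp: E_def Pair abs_le_square_iff[symmetric] abs_mult)
    also have "prob \<dots> \<le> expectation (\<lambda>\<omega>. (compensated_count m i j \<omega>)\<^sup>2) / (\<eta> * m)\<^sup>2"
      using assms int by (intro integral_Markov_inequality_measure[where A = "{}"]) auto
    also have "\<dots> \<le> real m / (\<eta> * m)\<^sup>2"
      by (intro divide_right_mono expectation_compensated_count_square_le) simp
    also have "\<dots> = 1 / (\<eta>\<^sup>2 * m)"
      using assms by (simp add: field_simps power2_eq_square)
    finally show ?thesis .
  qed
  have [measurable]: "E p \<in> events" for p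
    unfolding E_def by (cases p) simp
  have "{\<omega> \<in> space M. \<exists>i j. \<bar>compensated_count m i j \<omega>\<bar> \<ge> \<eta> * m} = (\<Union>p\<in>UNIV. E p)"
    by (auto simp: E_def)
  also have "prob \<dots> \<le> (\<Sum>p\<in>UNIV. prob (E p))"
    by (intro finite_measure_subadditive_finite) auto
  also have "\<dots> \<le> (\<Sum>p\<in>(UNIV :: ('s \<times> 's) set). 1 / (\<eta>\<^sup>2 * m))"
    by (intro sum_mono E_prob)
  also have "\<dots> = (real CARD('s))\<^sup>2 / (\<eta>\<^sup>2 * m)"
    by (simp add: card_prod power2_eq_square)
  finally show ?thesis .
qed

end

section \<open>Doeblin contraction\<close>

lemma row_stochastic_contraction:
  fixes K :: "'s::finite \<Rightarrow> 's \<Rightarrow> real"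
  assumes ge: "\<And>i j. \<kappa> \<le> K i j" and row: "\<And>i. (\<Sum>j\<in>UNIV. K i j) = 1" and "sum v UNIV = 0"
  shows "real CARD('s) * \<kappa> * (\<Sum>i\<in>UNIV. \<bar>v i\<bar>) \<le> (\<Sum>j\<in>UNIV. \<bar>v j - (\<Sum>i\<in>UNIV. v i * K i j)\<bar>)"
proof -
  \<comment> \<open>Subtracting \<open>\<kappa>\<close> from every entry changes nothing on \<open>v\<close>, and leaves row sums \<open>1 - n \<kappa>\<close>.\<close>
  have "\<bar>\<Sum>i\<in>UNIV. v i * K i j\<bar> \<le> (\<Sum>i\<in>UNIV. \<bar>v i\<bar> * (K i j - \<kappa>))" for j
  proof -
    have "(\<Sum>i\<in>UNIV. v i * K i j) = (\<Sum>i\<in>UNIV. v i * (K i j - \<kappa>))"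
      using assms(3) by (simp add: right_diff_distrib sum_subtractf flip: sum_distrib_right)
    also have "\<bar>\<dots>\<bar> \<le> (\<Sum>i\<in>UNIV. \<bar>v i * (K i j - \<kappa>)\<bar>)"
      by (rule sum_abs)
    finally show ?thesis
      using ge by (simp add: abs_mult)
  qed
  then have "(\<Sum>j\<in>UNIV. \<bar>\<Sum>i\<in>UNIV. v i * K i j\<bar>) \<le> (\<Sum>j\<in>UNIV. \<Sum>i\<in>UNIV. \<bar>v i\<bar> * (K i j - \<kappa>))"
    by (rule sum_mono)
  also have "\<dots> = (\<Sum>i\<in>UNIV. \<bar>v i\<bar> * (\<Sum>j\<in>UNIV. K i j - \<kappa>))"
    by (subst sum.swap) (simp add: sum_distrib_left)
  also have "\<dots> = (1 - real CARD('s) * \<kappa>) * (\<Sum>i\<in>UNIV. \<bar>v i\<bar>)"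
    by (simp add: sum_subtractf row mult.commute flip: sum_distrib_right)
  finally have 1: "(\<Sum>j\<in>UNIV. \<bar>\<Sum>i\<in>UNIV. v i * K i j\<bar>) \<le> \<dots>" .
  have "(\<Sum>j\<in>UNIV. \<bar>v j\<bar>) \<le> (\<Sum>j\<in>UNIV. \<bar>v j - (\<Sum>i\<in>UNIV. v i * K i j)\<bar> + \<bar>\<Sum>i\<in>UNIV. v i * K i j\<bar>)"
    by (intro sum_mono) linarith
  with 1 show ?thesis
    by (simp add: sum.distrib algebra_simps)
qed

section \<open>Weak law for transition frequencies\<close>

context finite_markov_chain
begin

lemma compensated_count_eq:
  "compensated_count m i j \<omega>
    = real (transition_count X m i j \<omega>) - (\<Sum>t<m. of_bool (X t \<omega> = i)) * K i j"
  by (simp add: compensated_count_def transition_count_eq_sum right_diff_distrib sum_subtractf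
      sum_distrib_right)

text \<open>A deterministic estimate along one path: the vector \<open>v\<close> of occupation
  counts minus \<open>m\<close> times \<pi> has mass 0 and is almost fixed by \<open>K\<close>, so
  the contraction bounds it.\<close>

lemma transition_count_near_stationary:
  assumes \<kappa>: "\<kappa> > 0" "\<And>i j. \<kappa> \<le> K i j" and row: "\<And>i. (\<Sum>j\<in>UNIV. K i j) = 1"
    and \<pi>: "sum \<pi> UNIV = 1" "\<And>j. (\<Sum>i\<in>UNIV. \<pi> i * K i j) = \<pi> j"
    and m: "m > 0" "1 \<le> \<eta> * m"
    and dev: "\<And>i j. \<bar>compensated_count m i j \<omega>\<bar> \<le> \<eta> * m"
  shows "\<bar>transition_count X m i j \<omega> / m - \<pi> i * K i j\<bar> \<le> \<eta> * (1 + (real CARD('s) + 1) / \<kappa>)"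
proof -
  define N :: "'s \<Rightarrow> real" where "N i = (\<Sum>t<m. of_bool (X t \<omega> = i))" for i
  define v where "v i = N i - m * \<pi> i" for i
  let ?n = "real CARD('s)"
  have "(\<Sum>i\<in>UNIV. N i) = (\<Sum>t<m. \<Sum>i\<in>UNIV. of_bool (X t \<omega> = i))"
    unfolding N_def by (rule sum.swap)
  also have "\<dots> = real m"
    by (simp add: of_bool_def)
  finally have v0: "sum v UNIV = 0"
    using \<pi>(1) by (simp add: v_def sum_subtractf flip: sum_distrib_left)
  \<comment> \<open>The \<open>?n\<close> deviations contribute \<open>?n * \<eta> * m\<close>; the
    two endpoint terms together contribute at most 1, hence at most
    \<open>\<eta> * m\<close>.\<close>
  have "\<bar>v j - (\<Sum>i\<in>UNIV. v i * K i j)\<bar> \<le> \<eta> * m * (?n + 1)" for j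
  proof -
    have "(\<Sum>i\<in>UNIV. real (transition_count X m i j \<omega>))
        = (\<Sum>t<m. \<Sum>i\<in>UNIV. of_bool (X t \<omega> = i) * of_bool (X (Suc t) \<omega> = j))"
      unfolding transition_count_eq_sum by (rule sum.swap)
    also have "\<dots> = (\<Sum>t<m. of_bool (X (Suc t) \<omega> = j))"
      by (simp add: of_bool_def flip: sum_distrib_right)
    \<comment> \<open>Arrivals are counted at times 1 to \<open>m\<close>, visits in
      \<open>N\<close> at times 0 to \<open>m - 1\<close>, so only the endpoints differ.\<close>
    also have "\<dots> = N j + of_bool (X m \<omega> = j) - of_bool (X 0 \<omega> = j)"
      using sum.lessThan_Suc_shift[of "\<lambda>t. of_bool (X t \<omega> = j) :: real" m] by (simp add: N_def)
    finally have C: "(\<Sum>i\<in>UNIV. real (transition_count X m i j \<omega>)) = \<dots>" .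
    have "(\<Sum>i\<in>UNIV. v i * K i j) = (\<Sum>i\<in>UNIV. N i * K i j) - m * \<pi> j"
      by (simp add: v_def left_diff_distrib sum_subtractf mult.assoc \<pi>(2) flip: sum_distrib_left)
    then have "v j - (\<Sum>i\<in>UNIV. v i * K i j)
        = (\<Sum>i\<in>UNIV. compensated_count m i j \<omega>) + of_bool (X 0 \<omega> = j) - of_bool (X m \<omega> = j)"
      using C by (simp add: compensated_count_eq sum_subtractf v_def N_def)
    moreover have "\<bar>\<Sum>i\<in>UNIV. compensated_count m i j \<omega>\<bar> \<le> (\<Sum>i\<in>(UNIV::'s set). \<eta> * m)"
      by (intro order_trans[OF sum_abs] sum_mono dev)
    moreover have "\<bar>of_bool (X 0 \<omega> = j) - of_bool (X m \<omega> = j)\<bar> \<le> (1::real)"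
      by simp
    ultimately show ?thesis
      using m(2) by (simp add: algebra_simps)
  qed
  then have "(\<Sum>j\<in>UNIV. \<bar>v j - (\<Sum>i\<in>UNIV. v i * K i j)\<bar>) \<le> (\<Sum>j\<in>(UNIV::'s set). \<eta> * m * (?n + 1))"
    by (intro sum_mono)
  \<comment> \<open>The factor \<open>?n\<close> of the contraction bound cancels against the one
    from summing over \<open>j\<close>.\<close>
  with row_stochastic_contraction[of \<kappa> K v, OF \<kappa>(2) row v0]
  have "?n * (\<kappa> * (\<Sum>i\<in>UNIV. \<bar>v i\<bar>)) \<le> ?n * (\<eta> * m * (?n + 1))"
    by (simp only: mult.assoc sum_constant)
  then have "\<kappa> * (\<Sum>i\<in>UNIV. \<bar>v i\<bar>) \<le> \<eta> * m * (?n + 1)"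
    by (rule mult_left_le_imp_le) (simp add: zero_less_card_finite)
  moreover have "\<bar>v i\<bar> \<le> (\<Sum>i\<in>UNIV. \<bar>v i\<bar>)"
    by (rule member_le_sum) auto
  ultimately have vi: "\<bar>v i\<bar> \<le> \<eta> * m * (?n + 1) / \<kappa>"
    using \<kappa>(1) by (simp add: pos_le_divide_eq mult.commute)
      (smt (verit) mult_left_mono)
  \<comment> \<open>The error splits into a martingale fluctuation and the error of the occupation
    count.\<close>
  have "transition_count X m i j \<omega> - m * (\<pi> i * K i j) = compensated_count m i j \<omega> + v i * K i j"
    by (simp add: compensated_count_eq v_def N_def algebra_simps)
  moreover have "\<bar>v i * K i j\<bar> \<le> \<bar>v i\<bar>"
    using K_nonneg[of i j] K_le_1[of i j] by (simp add: abs_mult mult_left_le)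
  ultimately have "\<bar>transition_count X m i j \<omega> - m * (\<pi> i * K i j)\<bar> \<le> m * (\<eta> * (1 + (?n + 1) / \<kappa>))"
    using vi dev[of i j] by (simp add: algebra_simps add_divide_distrib)
  moreover have "transition_count X m i j \<omega> / m - \<pi> i * K i j
      = (transition_count X m i j \<omega> - m * (\<pi> i * K i j)) / m"
    using m(1) by (simp add: field_simps)
  ultimately show ?thesis
    using m(1) by (simp add: abs_divide pos_divide_le_eq mult.commute)
qed

text \<open>Combines the pathwise estimate with the probability bound. One measurable exceptional
  event \<open>B\<close> serves all pairs \<open>(i, j)\<close> at once.\<close>

lemma transition_frequency_weak_law:
  assumes \<kappa>: "\<kappa> > 0" "\<And>i j. \<kappa> \<le> K i j" and row: "\<And>i. (\<Sum>j\<in>UNIV. K i j) = 1"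
    and \<pi>: "sum \<pi> UNIV = 1" "\<And>j. (\<Sum>i\<in>UNIV. \<pi> i * K i j) = \<pi> j"
    and "\<rho> > 0" "\<epsilon> > 0"
  obtains m B where "m > 0" "B \<in> events" "prob B < \<epsilon>"
    "\<And>\<omega> i j. \<omega> \<in> space M - B \<Longrightarrow> \<bar>transition_count X m i j \<omega> / m - \<pi> i * K i j\<bar> \<le> \<rho>"
proof -
  define \<eta> where "\<eta> = \<rho> / (1 + (real CARD('s) + 1) / \<kappa>)"
  have pos: "1 + (real CARD('s) + 1) / \<kappa> > 0"
    using \<kappa>(1) by (simp add: add_pos_nonneg)
  then have \<eta>: "\<eta> > 0" "\<eta> * (1 + (real CARD('s) + 1) / \<kappa>) = \<rho>"
    using \<open>\<rho> > 0\<close> by (simp_all add: \<eta>_def)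
  \<comment> \<open>The first threshold absorbs the endpoint terms, the second makes the exceptional
    probability less than \<epsilon>.\<close>
  obtain m :: nat where m: "real m > max (1 / \<eta>) ((real CARD('s))\<^sup>2 / (\<eta>\<^sup>2 * \<epsilon>))"
    using reals_Archimedean2 by blast
  moreover have "1 / \<eta> > 0"
    using \<eta>(1) by simp
  ultimately have m0: "m > 0"
    by linarith
  have "1 \<le> \<eta> * m" "(real CARD('s))\<^sup>2 / (\<eta>\<^sup>2 * m) < \<epsilon>"
    using m m0 \<eta>(1) \<open>\<epsilon> > 0\<close> by (simp_all add: field_simps)
  moreover define B where "B = {\<omega> \<in> space M. \<exists>i j. \<bar>compensated_count m i j \<omega>\<bar> \<ge> \<eta> * m}"
  ultimately have "prob B < \<epsilon>"
    using prob_compensated_count_ge[OF \<eta>(1) m0] by simp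
  moreover have "B \<in> events"
    unfolding B_def by measurable
  moreover have "\<bar>transition_count X m i j \<omega> / m - \<pi> i * K i j\<bar> \<le> \<rho>" if "\<omega> \<in> space M - B" for \<omega> i j
    unfolding \<eta>(2)[symmetric] using that
    by (intro transition_count_near_stationary[OF \<kappa> row \<pi> m0 \<open>1 \<le> \<eta> * m\<close>])
      (auto simp: B_def not_le intro: less_imp_le)
  ultimately show ?thesis
    using that m0 by blast
qed

end

section \<open>Gaussian weights and passage to logarithms\<close>

theorem lemmaS1p1:
  fixes x :: "'n::finite \<Rightarrow> real ^ 'd"
    and \<sigma> :: real
    and M :: "'w measure"
    and X :: "nat \<Rightarrow> 'w \<Rightarrow> 'n"
    and \<delta> \<epsilon> :: real
  assumes "\<sigma> > 0"
    and "markov_chain M (gauss_transition x \<sigma>) X"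
    and "\<delta> > 0"
    and "\<epsilon> > 0"
  shows "\<exists>(m::nat) (a :: 'n \<Rightarrow> real) (b :: 'n \<Rightarrow> real).
    \<P>(\<omega> in M. (SUP (i, j). \<bar>neg_log (transition_count X m i j \<omega>)
        - ereal ((norm (x i - x j))\<^sup>2 / \<sigma>\<^sup>2) + ereal (a i) + ereal (b j)\<bar>) > ereal \<delta>) < \<epsilon>"
proof -
  define w where "w i j = exp (- (norm (x i - x j))\<^sup>2 / \<sigma>\<^sup>2)" for i j
  define Z where "Z i = (\<Sum>j\<in>UNIV. w i j)" for i
  define W where "W = (\<Sum>i\<in>UNIV. Z i)"
  define K where "K = gauss_transition x \<sigma>"
  define \<kappa> where "\<kappa> = Min (range (\<lambda>(i, j). K i j))"
  define \<mu> where "\<mu> = Min (range (\<lambda>(i, j). w i j))"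
  have w_pos: "w i j > 0" and w_sym: "w i j = w j i" for i j
    by (simp_all add: w_def norm_minus_commute)
  have Z_pos: "Z i > 0" for i
    unfolding Z_def by (intro sum_pos) (auto simp: w_pos)
  have W_pos: "W > 0"
    unfolding W_def by (intro sum_pos) (auto simp: Z_pos)
  have K_eq: "K i j = w i j / Z i" for i j
    by (simp add: K_def gauss_transition_def w_def Z_def)
  have K_pos: "K i j > 0" for i j
    by (simp add: K_eq w_pos Z_pos)
  have w_le_Z: "w i j \<le> Z i" for i j
    unfolding Z_def by (rule member_le_sum) (auto simp: less_imp_le w_pos)
  have K_le: "K i j \<le> 1" for i j
    using w_le_Z[of i j] Z_pos[of i] by (simp add: K_eq)
  interpret markov_chain M K X
    unfolding K_def by (rule assms(2))
  interpret finite_markov_chain M K X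
    by unfold_locales (simp_all add: K_le less_imp_le K_pos)
  have \<kappa>: "\<kappa> > 0" "\<kappa> \<le> K i j" for i j
    unfolding \<kappa>_def by (auto simp: K_pos Min_gr_iff intro!: Min_le range_eqI[of _ _ "(i, j)"])
  have \<mu>: "\<mu> > 0" "\<mu> \<le> w i j" for i j
    unfolding \<mu>_def by (auto simp: w_pos Min_gr_iff intro!: Min_le range_eqI[of _ _ "(i, j)"])
  have row: "(\<Sum>j\<in>UNIV. K i j) = 1" for i
    using Z_pos[of i] by (simp add: K_eq Z_def flip: sum_divide_distrib)
  \<comment> \<open>Detailed balance: the right-hand side is symmetric in \<open>i\<close> and
    \<open>j\<close>, which yields stationarity of \<open>Z i / W\<close>.\<close>
  have \<pi>K: "Z i / W * K i j = w i j / W" for i j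
    using Z_pos[of i] by (simp add: K_eq)
  have \<pi>_sum: "(\<Sum>i\<in>UNIV. Z i / W) = 1"
    using W_pos by (simp add: W_def flip: sum_divide_distrib)
  have \<pi>_stat: "(\<Sum>i\<in>UNIV. Z i / W * K i j) = Z j / W" for j
  proof -
    have "(\<Sum>i\<in>UNIV. w i j) = Z j"
      unfolding Z_def by (simp add: w_sym[of _ j])
    then show ?thesis
      unfolding \<pi>K by (simp flip: sum_divide_distrib)
  qed
  have "isCont ln (1::real)"
    by (rule isCont_ln) simp
  then obtain r where r: "r > 0" "\<And>y::real. \<bar>y - 1\<bar> < r \<Longrightarrow> \<bar>ln y\<bar> < \<delta>"
    using \<open>\<delta> > 0\<close> unfolding continuous_at_eps_delta dist_real_def by (metis diff_zero ln_one)
  \<comment> \<open>As \<mu> is the least weight, an error \<rho> in the frequency is a relative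
    error of at most \<open>min r 1 / 2\<close>: below \<open>r\<close> for the logarithm, and below
    1 to exclude a zero count.\<close>
  define \<rho> where "\<rho> = min r 1 / 2 * \<mu> / W"
  have "\<rho> > 0"
    using r(1) \<mu>(1) W_pos by (simp add: \<rho>_def)
  then obtain m B where m: "m > 0" and B: "B \<in> events" "prob B < \<epsilon>"
    and freq: "\<And>\<omega> i j. \<omega> \<in> space M - B \<Longrightarrow> \<bar>transition_count X m i j \<omega> / m - w i j / W\<bar> \<le> \<rho>"
    using transition_frequency_weak_law[OF \<kappa> row \<pi>_sum \<pi>_stat _ \<open>\<epsilon> > 0\<close>, of \<rho>]
    unfolding \<pi>K by blast
  define a where "a i = ln (m / W)" for i :: 'n
  have good: "\<bar>neg_log (transition_count X m i j \<omega>) - ereal ((norm (x i - x j))\<^sup>2 / \<sigma>\<^sup>2)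
      + ereal (a i) + ereal 0\<bar> \<le> ereal \<delta>"
    if "\<omega> \<in> space M - B" for i j \<omega>
  proof -
    define c where "c = transition_count X m i j \<omega>"
    \<comment> \<open>The ratio of the count to its predicted value \<open>m * w i j / W\<close>;
      the quantity to be bounded turns out to be \<open>- ln y\<close>.\<close>
    define y where "y = c * W / (m * w i j)"
    have "y - 1 = (c / m - w i j / W) * (W / w i j)"
      using m W_pos w_pos[of i j] by (simp add: y_def field_simps)
    then have "\<bar>y - 1\<bar> = \<bar>c / m - w i j / W\<bar> * (W / w i j)"
      using W_pos w_pos[of i j] by (simp add: abs_mult)
    also have "\<dots> \<le> \<rho> * (W / w i j)"
      using freq[OF that, of i j] W_pos w_pos[of i j] by (intro mult_right_mono) (auto simp: c_def)
    also have "\<dots> = min r 1 / 2 * (\<mu> / w i j)"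
      using W_pos by (simp add: \<rho>_def)
    also have "\<dots> \<le> min r 1 / 2 * 1"
      using r(1) \<mu>(2)[of i j] w_pos[of i j] by (intro mult_left_mono) auto
    finally have y: "\<bar>y - 1\<bar> \<le> min r 1 / 2" by simp
    then have "\<bar>ln y\<bar> < \<delta>" "y > 0"
      using r by (simp, linarith)
    \<comment> \<open>A zero count would give \<open>y = 0\<close>; hence \<open>neg_log\<close>
      takes its finite branch.\<close>
    then have c: "c > 0"
      by (cases c) (auto simp: y_def)
    have "ln y = ln c + ln W - (ln m + ln (w i j))"
      using c m W_pos w_pos[of i j] by (simp add: y_def ln_mult ln_div)
    then have "- ln c - (norm (x i - x j))\<^sup>2 / \<sigma>\<^sup>2 + a i = - ln y"
      using m W_pos by (simp add: a_def ln_div w_def)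
    with \<open>\<bar>ln y\<bar> < \<delta>\<close> c show ?thesis
      unfolding c_def[symmetric] by (simp add: neg_log_def)
  qed
  have "(SUP (i, j). \<bar>neg_log (transition_count X m i j \<omega>) - ereal ((norm (x i - x j))\<^sup>2 / \<sigma>\<^sup>2)
      + ereal (a i) + ereal 0\<bar>) \<le> ereal \<delta>" if "\<omega> \<in> space M - B" for \<omega>
    using good[OF that] by (intro SUP_least) auto
  then have "\<P>(\<omega> in M. (SUP (i, j). \<bar>neg_log (transition_count X m i j \<omega>)
      - ereal ((norm (x i - x j))\<^sup>2 / \<sigma>\<^sup>2) + ereal (a i) + ereal 0\<bar>) > ereal \<delta>) \<le> prob B"
    by (intro finite_measure_mono B(1) subsetI) (metis (mono_tags, lifting) Diff_iff leD mem_Collect_eq)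
  with B(2) show ?thesis
    by (intro exI[of _ m] exI[of _ a] exI[of _ "\<lambda>_. 0"]) simp
qed

end
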